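(* Let $G$ be a locally compact abelian group. If $\mu\in\mathcal{WAP}_0(G)$ is a null weakly almost periodic measure, then every element of its hull is null weakly almost periodic, i.e. $\mathbb{X}(\mu)\subset\mathcal{WAP}_0(G)$.
   Context: $C_c(G)$: continuous compactly supported functions on $G$; $C_u(G)$: Banach space of bounded uniformly continuous complex functions, sup norm. $\theta_G$ (also $dt$) is Haar measure. Measures are (complex) Radon measures on $G$; the vague topology is the weak-* topology of the duality with $C_c(G)$. $\mu$ is translation bounded if $\sup_{x\in G}|\mu|(x+K)<\infty$ for all compact $K$ ($|\mu|$ the variation). $(c*\mu)(x)=\int_G c(x-t)\,d\mu(t)$; $T^tf(x)=f(x-t)$, $T^t\mu=\delta_t*\mu$. The hull $\mathbb{X}(\mu)$ is the vague closure of $\{T^t\mu:t\in G\}$. $f\in C_u(G)$ is weakly almost periodic if $\{T^tf:t\in G\}$ is precompact in the weak topology of $C_u(G)$. $G$ is assumed to admit Følner sequences: sequences $(A_n)$ of compact sets of positive measure with $\theta_G(A_n\triangle(x+A_n))/\theta_G(A_n)\to0$ for all $x\in G$. Every weakly almost periodic $f$ has a mean $M(f)=\lim_n\frac1{\theta_G(A_n)}\int_{x+A_n}f(t)\,dt$, uniformly in $x\in G$, independent of the Følner sequence. A weakly almost periodic function $f$ is null weakly almost periodic if $M(|f|)=0$ ($|f|$ is again weakly almost periodic). $\mathcal{WAP}_0(G)$ is the set of translation bounded measures $\mu$ such that $c*\mu$ is a null weakly almost periodic function for all $c\in C_c(G)$. *)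

theory Defs
  imports "HOL-Analysis.Analysis"
begin

text \<open>
  A locally compact abelian group is a type of sort
  \<open>{topological_ab_group_add, t2_space}\<close> with \<open>locally_compact_space euclidean\<close>.
\<close>

section \<open>Function spaces\<close>

definition Cc :: "('a::topological_space \<Rightarrow> 'b::real_normed_vector) set" where
  "Cc = {f. continuous_on UNIV f \<and> compact (closure {x. f x \<noteq> 0})}"

definition sup_norm :: "('a \<Rightarrow> complex) \<Rightarrow> real" where
  "sup_norm f = (SUP x. norm (f x))"

text \<open>Uniform continuity refers to the canonical group uniformity.\<close>

definition Cu :: "('a::topological_ab_group_add \<Rightarrow> complex) set" where
  "Cu = {f. bounded (range f) \<and>
            (\<forall>e>0. \<exists>U. open U \<and> 0 \<in> U \<and> (\<forall>x y. x - y \<in> U \<longrightarrow> dist (f x) (f y) < e))}"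

definition shift :: "'a::ab_group_add \<Rightarrow> ('a \<Rightarrow> complex) \<Rightarrow> ('a \<Rightarrow> complex)" where
  "shift t f = (\<lambda>x. f (x - t))"

definition linear_on_space :: "('a \<Rightarrow> complex) set \<Rightarrow> (('a \<Rightarrow> complex) \<Rightarrow> complex) \<Rightarrow> bool" where
  "linear_on_space V \<phi> \<longleftrightarrow>
     (\<forall>f\<in>V. \<forall>g\<in>V. \<phi> (\<lambda>x. f x + g x) = \<phi> f + \<phi> g) \<and>
     (\<forall>a. \<forall>f\<in>V. \<phi> (\<lambda>x. a * f x) = a * \<phi> f)"

definition Cu_dual :: "(('a::topological_ab_group_add \<Rightarrow> complex) \<Rightarrow> complex) set" where
  "Cu_dual = {\<phi> \<in> extensional Cu. linear_on_space Cu \<phi> \<and>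
                (\<exists>C. \<forall>f\<in>Cu. norm (\<phi> f) \<le> C * sup_norm f)}"

text \<open>The initial topology on \<open>Cu\<close> for the evaluations at all elements of the dual space.\<close>

definition weak_topology :: "('a::topological_ab_group_add \<Rightarrow> complex) topology" where
  "weak_topology =
     pullback_topology Cu (\<lambda>f. \<lambda>\<phi>\<in>Cu_dual. \<phi> f) (product_topology (\<lambda>_. euclidean) Cu_dual)"

text \<open>Precompact means that the weak closure is weakly compact.\<close>

definition weakly_almost_periodic :: "('a::topological_ab_group_add \<Rightarrow> complex) \<Rightarrow> bool" where
  "weakly_almost_periodic f \<longleftrightarrow>
     f \<in> Cu \<and> compactin weak_topology (weak_topology closure_of (range (\<lambda>t. shift t f)))"


section \<open>Haar measure, Foelner sequences and means\<close>

definition haar_measure :: "'a::topological_ab_group_add measure \<Rightarrow> bool" where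
  "haar_measure \<theta> \<longleftrightarrow>
     sets \<theta> = sets borel \<and>
     emeasure \<theta> UNIV \<noteq> 0 \<and>
     (\<forall>x. \<forall>B\<in>sets borel. emeasure \<theta> ((+) x ` B) = emeasure \<theta> B) \<and>
     (\<forall>K. compact K \<longrightarrow> emeasure \<theta> K < \<infinity>) \<and>
     (\<forall>B\<in>sets borel. emeasure \<theta> B = (INF U\<in>{U. open U \<and> B \<subseteq> U}. emeasure \<theta> U)) \<and>
     (\<forall>U. open U \<longrightarrow> emeasure \<theta> U = (SUP K\<in>{K. compact K \<and> K \<subseteq> U}. emeasure \<theta> K))"

definition folner_sequence ::
  "'a::topological_ab_group_add measure \<Rightarrow> (nat \<Rightarrow> 'a set) \<Rightarrow> bool" where
  "folner_sequence \<theta> A \<longleftrightarrow>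
     (\<forall>n. compact (A n) \<and> 0 < measure \<theta> (A n)) \<and>
     (\<forall>x. (\<lambda>n. measure \<theta> (sym_diff (A n) ((+) x ` A n)) / measure \<theta> (A n)) \<longlonglongrightarrow> 0)"

text \<open>
  The averages converge to \<open>m\<close> uniformly in the translate, along every Foelner sequence.
  If there is a Foelner sequence, then every weakly almost periodic function has exactly
  one mean in this sense.
\<close>

definition has_mean ::
  "'a::topological_ab_group_add measure \<Rightarrow> ('a \<Rightarrow> complex) \<Rightarrow> complex \<Rightarrow> bool" where
  "has_mean \<theta> f m \<longleftrightarrow>
     (\<forall>A. folner_sequence \<theta> A \<longrightarrow>
        uniform_limit UNIV
          (\<lambda>n x. (LINT t:((+) x ` A n)|\<theta>. f t) / complex_of_real (measure \<theta> (A n)))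
          (\<lambda>_. m) sequentially)"

definition null_weakly_almost_periodic ::
  "'a::topological_ab_group_add measure \<Rightarrow> ('a \<Rightarrow> complex) \<Rightarrow> bool" where
  "null_weakly_almost_periodic \<theta> f \<longleftrightarrow>
     weakly_almost_periodic f \<and> has_mean \<theta> (\<lambda>x. complex_of_real (norm (f x))) 0"


section \<open>Complex Radon measures\<close>

text \<open>
  A complex Radon measure, possibly of infinite total variation, is not a complex-valued
  function on all Borel sets. As in Bourbaki, it is a linear functional on \<open>Cc\<close> that is
  continuous on the functions supported in any fixed compact set; the value
  \<open>\<mu> f\<close> is the integral of \<open>f\<close> against \<open>\<mu>\<close>.
  Outside \<open>Cc\<close> the functional is \<open>undefined\<close>, so that equality of measures is equality in HOL.
\<close>

type_synonym 'a functional = "('a \<Rightarrow> complex) \<Rightarrow> complex"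

definition radon_measures :: "'a::topological_space functional set" where
  "radon_measures = {\<mu> \<in> extensional Cc. linear_on_space Cc \<mu> \<and>
     (\<forall>K. compact K \<longrightarrow>
        (\<exists>C. \<forall>f\<in>Cc. closure {x. f x \<noteq> 0} \<subseteq> K \<longrightarrow> norm (\<mu> f) \<le> C * sup_norm f))}"

text \<open>The weak-* topology is the topology of pointwise convergence on \<open>Cc\<close>.\<close>

definition vague_topology :: "'a::topological_space functional topology" where
  "vague_topology = subtopology (product_topology (\<lambda>_. euclidean) Cc) radon_measures"

text \<open>
  The variation \<open>|\<mu>|\<close> is a positive Radon measure, given on a nonnegative \<open>c\<close> in \<open>Cc\<close> by
  \<open>|\<mu>|(c) = sup {|\<mu>(h)| : h \<in> Cc, |h| \<le> c}\<close>. By regularity its value on a compact set \<open>K\<close>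
  is the infimum of \<open>|\<mu>|(c)\<close> over all \<open>c\<close> in \<open>Cc\<close> that dominate the indicator function of \<open>K\<close>.
\<close>

definition variation :: "'a::topological_space functional \<Rightarrow> ('a \<Rightarrow> real) \<Rightarrow> ennreal" where
  "variation \<mu> c = (SUP h\<in>{h\<in>Cc. \<forall>x. norm (h x) \<le> c x}. ennreal (norm (\<mu> h)))"

definition variation_compact :: "'a::topological_space functional \<Rightarrow> 'a set \<Rightarrow> ennreal" where
  "variation_compact \<mu> K = (INF c\<in>{c\<in>Cc. \<forall>x. indicator K x \<le> c x}. variation \<mu> c)"

definition translation_bounded :: "'a::topological_ab_group_add functional \<Rightarrow> bool" where
  "translation_bounded \<mu> \<longleftrightarrow>
     (\<forall>K. compact K \<longrightarrow> (SUP x. variation_compact \<mu> ((+) x ` K)) < \<infinity>)"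

definition convolve :: "('a::ab_group_add \<Rightarrow> complex) \<Rightarrow> 'a functional \<Rightarrow> ('a \<Rightarrow> complex)" where
  "convolve c \<mu> = (\<lambda>x. \<mu> (\<lambda>t. c (x - t)))"

text \<open>
  \<open>\<delta>\<^sub>t * \<mu>\<close> is the image of \<open>\<mu>\<close> under translation by \<open>t\<close>; it integrates \<open>f\<close> to the
  \<open>\<mu>\<close>-integral of \<open>s \<mapsto> f (s + t)\<close>.
\<close>

definition shift_measure ::
  "'a::topological_ab_group_add \<Rightarrow> 'a functional \<Rightarrow> 'a functional" where
  "shift_measure t \<mu> = (\<lambda>f\<in>Cc. \<mu> (\<lambda>s. f (s + t)))"

definition measure_hull :: "'a::topological_ab_group_add functional \<Rightarrow> 'a functional set" where
  "measure_hull \<mu> = vague_topology closure_of (range (\<lambda>t. shift_measure t \<mu>))"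

definition WAP0 :: "'a::topological_ab_group_add measure \<Rightarrow> 'a functional set" where
  "WAP0 \<theta> = {\<mu> \<in> radon_measures. translation_bounded \<mu> \<and>
                (\<forall>c\<in>Cc. null_weakly_almost_periodic \<theta> (convolve c \<mu>))}"

end

theory Submission
  imports Defs
begin

text \<open>
  On the weakly compact closure of the orbit of a weakly almost periodic \<open>f\<close> the weak topology
  agrees with the coarser Hausdorff topology of pointwise convergence, so the pointwise closure of
  the orbit lies in it. Since \<open>\<nu> \<mapsto> c * \<nu>\<close> is continuous from the vague to the pointwise
  topology, \<open>c * \<nu>\<close> lies in the closed orbit of \<open>c * \<mu>\<close> for every \<open>\<nu>\<close> in the hull, and is
  therefore weakly almost periodic. By equicontinuity the pointwise approximation by translates
  is uniform on compact sets, so the averages of \<open>|c * \<nu>|\<close> over \<open>x + A\<^sub>n\<close> are at most the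
  supremum over \<open>y\<close> of the averages of \<open>|c * \<mu>|\<close> over \<open>y + A\<^sub>n\<close>, which tends to 0.
\<close>

section \<open>The space \<open>Cu\<close>, and the weak and pointwise topologies on orbits\<close>

abbreviation pointwise_topology :: "('a \<Rightarrow> complex) topology" where
  "pointwise_topology \<equiv> product_topology (\<lambda>_. euclidean) UNIV"

lemma Hausdorff_space_euclidean_t2:
  "Hausdorff_space (euclidean :: 'a::t2_space topology)"
  unfolding Hausdorff_space_def by (simp add: disjnt_def) (meson hausdorff)

lemma shift_shift: "shift s (shift t f) = shift (s + t) f"
  by (simp add: shift_def algebra_simps)

lemma Cu_add:
  assumes f: "f \<in> Cu" and g: "g \<in> Cu"
  shows "(\<lambda>x. f x + g x) \<in> Cu"
proof -
  have bdd: "bounded (range (\<lambda>x. f x + g x))"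
  proof -
    obtain B C where B: "\<And>x. norm (f x) \<le> B" and C: "\<And>x. norm (g x) \<le> C"
      using f g unfolding Cu_def bounded_iff by auto
    show ?thesis
      unfolding bounded_iff
      by (intro exI[of _ "B + C"]) (auto intro!: norm_triangle_le add_mono B C)
  qed
  have "\<exists>U. open U \<and> 0 \<in> U \<and> (\<forall>x y. x - y \<in> U \<longrightarrow> dist (f x + g x) (f y + g y) < e)" if "e > 0" for e
  proof -
    have "e / 2 > 0" using that by simp
    obtain U where U: "open U" "0 \<in> U" "\<And>x y. x - y \<in> U \<Longrightarrow> dist (f x) (f y) < e / 2"
      using f \<open>e / 2 > 0\<close> unfolding Cu_def by blast
    obtain V where V: "open V" "0 \<in> V" "\<And>x y. x - y \<in> V \<Longrightarrow> dist (g x) (g y) < e / 2"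
      using g \<open>e / 2 > 0\<close> unfolding Cu_def by blast
    have "dist (f x + g x) (f y + g y) < e" if "x - y \<in> U \<inter> V" for x y
      using U(3)[of x y] V(3)[of x y] dist_triangle_add[of "f x" "g x" "f y" "g y"] that by auto
    then show ?thesis
      using U V by (intro exI[of _ "U \<inter> V"]) auto
  qed
  then show ?thesis using bdd by (simp add: Cu_def)
qed

lemma Cu_mult:
  assumes f: "f \<in> Cu"
  shows "(\<lambda>x. a * f x) \<in> Cu"
proof -
  obtain B where "\<And>x. norm (f x) \<le> B"
    using f unfolding Cu_def bounded_iff by auto
  then have bdd: "bounded (range (\<lambda>x. a * f x))"
    unfolding bounded_iff by (intro exI[of _ "norm a * B"]) (auto simp: norm_mult intro: mult_left_mono)
  have "\<exists>U. open U \<and> 0 \<in> U \<and> (\<forall>x y. x - y \<in> U \<longrightarrow> dist (a * f x) (a * f y) < e)" if "e > 0" for e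
  proof -
    \<comment> \<open>Dividing by \<open>norm a + 1\<close> rather than \<open>norm a\<close> covers
      the case \<open>a = 0\<close>.\<close>
    have "e / (norm a + 1) > 0" using that by (simp add: add_nonneg_pos)
    then obtain U where U: "open U" "0 \<in> U" "\<And>x y. x - y \<in> U \<Longrightarrow> dist (f x) (f y) < e / (norm a + 1)"
      using f unfolding Cu_def by blast
    have "dist (a * f x) (a * f y) < e" if "x - y \<in> U" for x y
    proof -
      have "dist (a * f x) (a * f y) = norm a * dist (f x) (f y)"
        by (simp add: dist_norm norm_mult flip: right_diff_distrib)
      also have "\<dots> \<le> (norm a + 1) * dist (f x) (f y)"
        by (intro mult_right_mono) auto
      also have "\<dots> < e"
        using U(3)[OF that] by (simp add: pos_less_divide_eq add_nonneg_pos mult.commute)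
      finally show ?thesis .
    qed
    then show ?thesis using U by blast
  qed
  then show ?thesis using bdd by (simp add: Cu_def)
qed

lemma shift_in_Cu:
  assumes "f \<in> Cu"
  shows "shift t f \<in> Cu"
proof -
  have "bounded (range (shift t f))"
    using assms bounded_subset[of "range f" "range (shift t f)"]
    unfolding Cu_def shift_def by auto
  moreover have "\<exists>U. open U \<and> 0 \<in> U \<and> (\<forall>x y. x - y \<in> U \<longrightarrow> dist (shift t f x) (shift t f y) < e)"
    if "e > 0" for e
  proof -
    obtain U where U: "open U" "0 \<in> U" "\<And>x y. x - y \<in> U \<Longrightarrow> dist (f x) (f y) < e"
      using assms \<open>e > 0\<close> unfolding Cu_def by blast
    have "dist (shift t f x) (shift t f y) < e" if "x - y \<in> U" for x y
      using U(3)[of "x - t" "y - t"] that by (simp add: shift_def)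
    then show ?thesis using U by blast
  qed
  ultimately show ?thesis by (simp add: Cu_def)
qed

text \<open>Evaluation at a point is linear and bounded by the sup norm with constant 1. These
  functionals are what makes the weak topology finer than the pointwise one.\<close>

lemma evaluation_in_Cu_dual: "(\<lambda>f\<in>Cu. f x) \<in> Cu_dual"
  unfolding Cu_dual_def mem_Collect_eq
proof (intro conjI exI ballI)
  show "linear_on_space Cu (\<lambda>f\<in>Cu. f x)"
    unfolding linear_on_space_def by (simp add: Cu_add Cu_mult)
  show "norm ((\<lambda>f\<in>Cu. f x) f) \<le> 1 * sup_norm f" if f: "f \<in> Cu" for f
  proof -
    \<comment> \<open>The supremum in \<open>sup_norm\<close> is a real one, so it bounds the values
      only once they are known to be bounded above.\<close>
    have "bdd_above (range (\<lambda>x. norm (f x)))"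
      using f unfolding Cu_def bounded_iff bdd_above_def by auto
    then show ?thesis
      unfolding sup_norm_def using f cSUP_upper[OF UNIV_I, of "\<lambda>x. norm (f x)" x] by simp
  qed
  show "(\<lambda>f\<in>Cu. f x) \<in> extensional Cu" by (rule restrict_extensional)
qed

lemma topspace_weak_topology [simp]: "topspace weak_topology = (Cu :: ('a::topological_ab_group_add \<Rightarrow> complex) set)"
proof -
  have "(\<lambda>\<phi>\<in>Cu_dual. \<phi> f) \<in> topspace (product_topology (\<lambda>_. euclidean) Cu_dual)"
    for f :: "'a \<Rightarrow> complex"
    unfolding topspace_product_topology by (rule restrict_PiE_iff[THEN iffD2]) simp
  then have "(\<lambda>f :: 'a \<Rightarrow> complex. \<lambda>\<phi>\<in>Cu_dual. \<phi> f) -` topspace (product_topology (\<lambda>_. euclidean) Cu_dual) = UNIV"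
    by (intro UNIV_eq_I[symmetric] vimageI2)
  then show ?thesis
    unfolding weak_topology_def topspace_pullback_topology by (simp only: Int_UNIV_left)
qed

lemma continuous_map_pullback_component:
  assumes "k \<in> I"
  shows "continuous_map (pullback_topology A h (product_topology X I)) (X k) (\<lambda>f. h f k)"
  using continuous_map_pullback[OF continuous_map_product_projection[OF assms, of X], of A h]
  by (simp add: o_def)

text \<open>Continuity into a product is tested on coordinates, and the coordinate at
  \<open>x\<close> is one of the components that define the weak topology, namely that of evaluation
  at \<open>x\<close>.\<close>

lemma continuous_map_weak_pointwise:
  "continuous_map weak_topology pointwise_topology (\<lambda>f. f)"
  unfolding continuous_map_componentwise_UNIV
proof
  fix x :: 'a
  define \<phi> :: "('a \<Rightarrow> complex) \<Rightarrow> complex" where "\<phi> = (\<lambda>f\<in>Cu. f x)"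
  have \<phi>: "\<phi> \<in> Cu_dual"
    unfolding \<phi>_def by (rule evaluation_in_Cu_dual)
  have "continuous_map weak_topology euclidean (\<lambda>f. (\<lambda>\<psi>\<in>Cu_dual. \<psi> f) \<phi>)"
    unfolding weak_topology_def 
    by (rule continuous_map_pullback_component[OF \<phi>, of Cu "\<lambda>f. \<lambda>\<psi>\<in>Cu_dual. \<psi> f" "\<lambda>_. euclidean"])
  then show "continuous_map weak_topology euclidean (\<lambda>f. f x)"
  \<comment> \<open>Evaluation as an element of \<open>Cu_dual\<close> is \<open>undefined\<close>
    outside \<open>Cu\<close>, so the two maps are compared only on the carrier of the weak
    topology.\<close>
  proof (rule continuous_map_eq)
    show "(\<lambda>\<psi>\<in>Cu_dual. \<psi> f) \<phi> = f x" if "f \<in> topspace weak_topology" for f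
      using that \<phi> unfolding \<phi>_def by simp
  qed
qed

lemma Hausdorff_space_pointwise: "Hausdorff_space pointwise_topology"
  unfolding Hausdorff_space_product_topology using Hausdorff_space_euclidean by blast

text \<open>The weakly compact closure of the orbit is also pointwise compact, as a continuous
  image, and hence closed in the Hausdorff pointwise topology. A pointwise closed set that contains
  the orbit contains its pointwise closure.\<close>

lemma pointwise_closure_of_orbit_subset:
  assumes "weakly_almost_periodic f"
  shows "pointwise_topology closure_of range (\<lambda>t. shift t f)
    \<subseteq> weak_topology closure_of range (\<lambda>t. shift t f)" (is "_ \<subseteq> ?K")
proof (rule closure_of_minimal)
  have "compactin pointwise_topology ?K"
    using image_compactin[OF conjunct2[OF assms[unfolded weakly_almost_periodic_def]]
        continuous_map_weak_pointwise]
    by (simp only: image_ident)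
  then show "closedin pointwise_topology ?K"
    by (rule compactin_imp_closedin[OF Hausdorff_space_pointwise])
  have "shift t f \<in> Cu" for t
    using assms unfolding weakly_almost_periodic_def by (intro shift_in_Cu) (rule conjunct1)
  then show "range (\<lambda>t. shift t f) \<subseteq> ?K"
    by (intro closure_of_subset image_subsetI) (simp only: topspace_weak_topology)
qed

lemma weakly_almost_periodic_pointwise_closure:
  assumes f: "weakly_almost_periodic f"
    and g: "g \<in> pointwise_topology closure_of range (\<lambda>t. shift t f)"
  shows "weakly_almost_periodic g"
proof -
  let ?K = "weak_topology closure_of range (\<lambda>t. shift t f)"
  have "g \<in> ?K"
    using pointwise_closure_of_orbit_subset[OF f] g by blast
  then have "g \<in> Cu"
    unfolding in_closure_of topspace_weak_topology by (rule conjunct1)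
  \<comment> \<open>Translation invariance is derived from the pointwise closure: there
    \<open>shift t\<close> is continuous at once, since its coordinate at \<open>x\<close> is the
    coordinate at \<open>x - t\<close>. Then the whole orbit of \<open>g\<close> lies in the compact
    set \<open>?K\<close>, and so does its weak closure.\<close>
  have "shift t g \<in> ?K" for t
  proof -
    have "continuous_map pointwise_topology pointwise_topology (shift t)"
      unfolding continuous_map_componentwise_UNIV shift_def
      by (intro allI continuous_map_product_projection) simp
    then have "shift t g \<in> pointwise_topology closure_of (shift t ` range (\<lambda>t. shift t f))"
      using continuous_map_image_closure_subset g by blast
    also have "shift t ` range (\<lambda>t. shift t f) \<subseteq> range (\<lambda>t. shift t f)"
      by (auto simp: shift_shift)
    then have "pointwise_topology closure_of (shift t ` range (\<lambda>t. shift t f))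
        \<subseteq> pointwise_topology closure_of range (\<lambda>t. shift t f)"
      by (rule closure_of_mono)
    finally show ?thesis
      using pointwise_closure_of_orbit_subset[OF f] by blast
  qed
  then have sub: "weak_topology closure_of range (\<lambda>t. shift t g) \<subseteq> ?K"
    by (intro closure_of_minimal image_subsetI closedin_closure_of)
  have "compactin weak_topology ?K"
    using f unfolding weakly_almost_periodic_def by (rule conjunct2)
  then have "compactin weak_topology (weak_topology closure_of range (\<lambda>t. shift t g))"
    using sub by (rule closed_compactin) (rule closedin_closure_of)
  with \<open>g \<in> Cu\<close> show ?thesis
    unfolding weakly_almost_periodic_def by (rule conjI)
qed

section \<open>Translates of sets, and pointwise approximation made uniform on compact sets\<close>

lemma translate_eq_vimage: "(+) x ` A = (\<lambda>t. t - x) -` (A :: 'a::ab_group_add set)"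
proof (intro set_eqI iffI)
  fix y assume "y \<in> (\<lambda>t. t - x) -` A"
  then have "x + (y - x) \<in> (+) x ` A" by blast
  then show "y \<in> (+) x ` A" by simp
qed auto

lemma indicator_translate: "indicator ((+) x ` A) s = indicator A (s - x)"
  for A :: "'a::ab_group_add set"
  unfolding translate_eq_vimage by (rule indicator_vimage)

lemma compact_translate:
  "compact K \<Longrightarrow> compact ((+) x ` K)" for K :: "'a::topological_ab_group_add set"
  by (rule compact_continuous_image[OF continuous_on_add[OF continuous_on_const continuous_on_id]])

lemma Cu_continuous_on:
  assumes "f \<in> Cu"
  shows "continuous_on UNIV f"
  unfolding continuous_on_def
proof
  fix x
  show "(f \<longlongrightarrow> f x) (at x within UNIV)"
  proof (rule tendstoI)
    fix e :: real assume "e > 0"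
    then obtain U where U: "open U" "0 \<in> U" "\<And>x y. x - y \<in> U \<Longrightarrow> dist (f x) (f y) < e"
      using assms unfolding Cu_def by blast
    have "((\<lambda>y. y - x) \<longlongrightarrow> x - x) (at x)"
      by (rule tendsto_diff[OF tendsto_ident_at tendsto_const])
    then have "((\<lambda>y. y - x) \<longlongrightarrow> 0) (at x)"
      by simp
    then have "\<forall>\<^sub>F y in at x. y - x \<in> U"
      using U(1,2) by (rule topological_tendstoD)
    then show "\<forall>\<^sub>F y in at x within UNIV. dist (f y) (f x) < e"
      by (rule eventually_mono) (rule U(3))
  qed
qed

text \<open>Being within \<open>e\<close> of \<open>g\<close> on the finite set \<open>F\<close>
  restricts only finitely many coordinates, so it is an open condition in the product topology and
  must meet \<open>S\<close>.\<close>

lemma pointwise_closure_approx_finite: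
  assumes "g \<in> pointwise_topology closure_of S" "finite F" "e > 0"
  obtains h where "h \<in> S" "\<And>x. x \<in> F \<Longrightarrow> dist (h x) (g x) < e"
proof -
  let ?W = "PiE UNIV (\<lambda>x. if x \<in> F then ball (g x) e else UNIV)"
  have "openin pointwise_topology ?W"
  proof (rule product_topology_basis)
    have "{x. (if x \<in> F then ball (g x) e else UNIV) \<noteq> topspace euclidean} \<subseteq> F"
      by auto
    then show "finite {x. (if x \<in> F then ball (g x) e else UNIV) \<noteq> topspace euclidean}"
      using \<open>finite F\<close> finite_subset by blast
  qed simp
  moreover have "g \<in> ?W" by (rule PiE_I) (simp_all add: \<open>e > 0\<close>)
  ultimately obtain h where "h \<in> S" and h: "h \<in> ?W"
    using assms(1)[unfolded in_closure_of, THEN conjunct2, rule_format, of ?W] by metis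
  moreover have "dist (h x) (g x) < e" if "x \<in> F" for x
    using PiE_mem[OF h UNIV_I, of x] \<open>x \<in> F\<close> by (simp add: dist_commute)
  ultimately show thesis using that by blast
qed

text \<open>A uniformly continuous function has an equicontinuous orbit, so pointwise
  approximation by its translates is uniform on compact sets.\<close>

lemma pointwise_closure_approx_compact:
  assumes f: "f \<in> Cu" and g: "g \<in> Cu"
    and cl: "g \<in> pointwise_topology closure_of range (\<lambda>t. shift t f)"
    and K: "compact K" and "e > 0"
  obtains t where "\<And>s. s \<in> K \<Longrightarrow> norm (g s - f (s - t)) < e"
proof -
  have "e / 3 > 0" using \<open>e > 0\<close> by simp
  obtain U where U: "open U" "0 \<in> U" "\<And>x y. x - y \<in> U \<Longrightarrow> dist (f x) (f y) < e / 3"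
    using f \<open>e / 3 > 0\<close> unfolding Cu_def by blast
  obtain V where V: "open V" "0 \<in> V" "\<And>x y. x - y \<in> V \<Longrightarrow> dist (g x) (g y) < e / 3"
    using g \<open>e / 3 > 0\<close> unfolding Cu_def by blast
  \<comment> \<open>On the neighbourhood \<open>N y\<close> of \<open>y\<close>, both
    \<open>g\<close> and every translate of \<open>f\<close> stay within \<open>e / 3\<close> of
    their values at \<open>y\<close>.\<close>
  define N where "N y = (\<lambda>s. s - y) -` (U \<inter> V)" for y
  have "open (N y)" for y
    unfolding N_def using U V by (intro open_vimage open_Int continuous_intros)
  moreover have "K \<subseteq> (\<Union>y\<in>K. N y)"
    using U V by (auto simp: N_def)
  ultimately obtain F where F: "F \<subseteq> K" "finite F" "K \<subseteq> (\<Union>y\<in>F. N y)"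
    using compactE_image[OF K, of K N] by metis
  obtain t where t: "\<And>y. y \<in> F \<Longrightarrow> dist (shift t f y) (g y) < e / 3"
    using pointwise_closure_approx_finite[OF cl \<open>finite F\<close> \<open>e / 3 > 0\<close>] by blast
  have "norm (g s - f (s - t)) < e" if "s \<in> K" for s
  proof -
    obtain y where y: "y \<in> F" "s - y \<in> U" "s - y \<in> V"
      using F(3) \<open>s \<in> K\<close> by (auto simp: N_def)
    have "dist (g s) (g y) < e / 3" using V(3) y by blast
    moreover have "dist (f (y - t)) (g y) < e / 3" using t[OF y(1)] by (simp add: shift_def)
    \<comment> \<open>The shift cancels in \<open>(s - t) - (y - t) = s - y\<close>, so
      \<open>U\<close>, chosen before \<open>t\<close>, serves for every \<open>t\<close>. This is
      the equicontinuity of the orbit.\<close>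
    moreover have "dist (f (s - t)) (f (y - t)) < e / 3" using U(3)[of "s - t" "y - t"] y by simp
    ultimately have "dist (g s) (f (s - t)) < e"
      using dist_triangle_third[of "g s" "g y" e "f (y - t)" "f (s - t)"]
      by (simp add: dist_commute)
    then show ?thesis by (simp add: dist_norm)
  qed
  then show thesis using that by blast
qed

section \<open>Haar measure and integrals over translated sets\<close>

lemma haar_measureD:
  assumes "haar_measure \<theta>"
  shows haar_measure_sets: "sets \<theta> = sets borel"
    and haar_measure_translate: "B \<in> sets borel \<Longrightarrow> emeasure \<theta> ((+) x ` B) = emeasure \<theta> B"
    and haar_measure_compact: "compact K \<Longrightarrow> emeasure \<theta> K < \<infinity>"
proof -
  note haar = assms[unfolded haar_measure_def]
  show "sets \<theta> = sets borel"
    by (rule haar[THEN conjunct1])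
  show "emeasure \<theta> ((+) x ` B) = emeasure \<theta> B" if "B \<in> sets borel"
    using that by (rule haar[THEN conjunct2, THEN conjunct2, THEN conjunct1, THEN spec, THEN bspec])
  show "emeasure \<theta> K < \<infinity>" if "compact K"
    using that by (rule haar[THEN conjunct2, THEN conjunct2, THEN conjunct2, THEN conjunct1, THEN spec, THEN mp])
qed

text \<open>The preimage of \<open>B\<close> under \<open>t \<mapsto> t - x\<close> is the translate
  of \<open>B\<close> by \<open>x\<close>. This form of invariance, as a fixed pushforward, permits
  a change of variables in integrals.\<close>

lemma haar_measure_distr_translate:
  assumes "haar_measure \<theta>"
  shows "distr \<theta> \<theta> (\<lambda>t. t - x) = \<theta>"
proof (rule measure_eqI)
  fix B assume "B \<in> sets (distr \<theta> \<theta> (\<lambda>t. t - x))"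
  then have B: "B \<in> sets borel"
    using haar_measure_sets[OF assms] by simp
  have sets: "sets \<theta> = sets borel" using assms by (rule haar_measure_sets)
  then have "space \<theta> = UNIV" by (metis sets_eq_imp_space_eq space_borel)
  have "(\<lambda>t. t - x) \<in> borel_measurable borel"
    by (intro borel_measurable_continuous_onI continuous_intros)
  then have "(\<lambda>t. t - x) \<in> measurable \<theta> \<theta>"
    using measurable_cong_sets[OF sets sets] by blast
  then have "emeasure (distr \<theta> \<theta> (\<lambda>t. t - x)) B = emeasure \<theta> ((+) x ` B)"
    using B sets \<open>space \<theta> = UNIV\<close> by (simp add: emeasure_distr translate_eq_vimage)
  also have "\<dots> = emeasure \<theta> B"
    using assms B by (rule haar_measure_translate)
  finally show "emeasure (distr \<theta> \<theta> (\<lambda>t. t - x)) B = emeasure \<theta> B" .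
qed simp

lemma haar_set_integral_translate:
  fixes u :: "'a::{topological_ab_group_add, t2_space} \<Rightarrow> real"
  assumes \<theta>: "haar_measure \<theta>" and u: "u \<in> borel_measurable borel" and A: "A \<in> sets borel"
  shows "(LINT s:((+) x ` A)|\<theta>. u (s - x)) = (LINT s:A|\<theta>. u s)"
proof -
  have sets: "sets \<theta> = sets borel" using \<theta> by (rule haar_measure_sets)
  have "(\<lambda>t. t - x) \<in> borel_measurable borel"
    by (intro borel_measurable_continuous_onI continuous_intros)
  then have tr: "(\<lambda>t. t - x) \<in> measurable \<theta> \<theta>"
    using measurable_cong_sets[OF sets sets] by blast
  have m: "(\<lambda>s. indicator A s *\<^sub>R u s) \<in> borel_measurable \<theta>"
    unfolding measurable_cong_sets[OF sets refl] using u A by measurable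
  have "(LINT s:A|\<theta>. u s) = (LINT s|distr \<theta> \<theta> (\<lambda>t. t - x). indicator A s *\<^sub>R u s)"
    unfolding set_lebesgue_integral_def haar_measure_distr_translate[OF \<theta>] ..
  also have "\<dots> = (LINT s|\<theta>. indicator A (s - x) *\<^sub>R u (s - x))"
    by (rule integral_distr[OF tr m])
  also have "(\<lambda>s. indicator A (s - x)) = (indicator ((+) x ` A) :: 'a \<Rightarrow> real)"
    by (rule ext) (simp only: indicator_translate)
  finally show ?thesis
    unfolding set_lebesgue_integral_def by metis
qed

text \<open>A bounded continuous function is integrable over a set of finite measure. Monotonicity
  and additivity of the integrals below rest on this.\<close>

lemma haar_set_integrable_Cu:
  fixes f :: "'a::{topological_ab_group_add, t2_space} \<Rightarrow> complex"
  assumes \<theta>: "haar_measure \<theta>" and f: "f \<in> Cu" and K: "compact K"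
  shows "set_integrable \<theta> K (\<lambda>s. norm (f s))"
proof -
  have sets: "sets \<theta> = sets borel" using \<theta> by (rule haar_measure_sets)
  obtain B where B: "\<And>s. norm (f s) \<le> B"
    using f unfolding Cu_def bounded_iff by auto
  have "(\<lambda>s. norm (f s)) \<in> borel_measurable borel"
    using Cu_continuous_on[OF f] by (intro borel_measurable_continuous_onI continuous_intros)
  then have "(\<lambda>s. norm (f s)) \<in> borel_measurable \<theta>"
    using measurable_cong_sets[OF sets refl] by blast
  moreover have "K \<in> sets \<theta>"
    using K sets by (simp add: compact_imp_closed)
  moreover have "emeasure \<theta> K < \<infinity>"
    using \<theta> K by (rule haar_measure_compact)
  ultimately show ?thesis
    unfolding set_integrable_def using B
    by (intro integrableI_bounded_set_indicator[where B = B]) auto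
qed

text \<open>On the compact translate of \<open>K\<close> by \<open>x\<close>, \<open>g\<close> is
  within \<open>e\<close> of some translate of \<open>f\<close>, and integrating that translate
  amounts to integrating \<open>f\<close> over another translate of \<open>K\<close>. Nothing is
  known about where the latter lies, so the estimate serves for bounds that are uniform over
  translates.\<close>

lemma set_integral_norm_pointwise_closure_le:
  fixes f g :: "'a::{topological_ab_group_add, t2_space} \<Rightarrow> complex"
  assumes \<theta>: "haar_measure \<theta>" and f: "f \<in> Cu" and g: "g \<in> Cu"
    and cl: "g \<in> pointwise_topology closure_of range (\<lambda>t. shift t f)"
    and K: "compact K" and "e > 0"
  obtains t where "(LINT s:((+) x ` K)|\<theta>. norm (g s))
    \<le> (LINT s:((+) t ` K)|\<theta>. norm (f s)) + e * measure \<theta> K"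
proof -
  have sets: "sets \<theta> = sets borel" using \<theta> by (rule haar_measure_sets)
  let ?K = "(+) x ` K"
  have K': "compact ?K" using K by (rule compact_translate)
  have "K \<in> sets borel"
    using K by (simp add: compact_imp_closed)
  then have meas_eq: "measure \<theta> ?K = measure \<theta> K"
    unfolding measure_def by (simp only: haar_measure_translate[OF \<theta>])
  have meas: "?K \<in> sets \<theta>" "emeasure \<theta> ?K \<noteq> \<infinity>"
    using K' sets haar_measure_compact[OF \<theta> K'] by (simp_all add: compact_imp_closed)
  obtain t where t: "\<And>s. s \<in> ?K \<Longrightarrow> norm (g s - f (s - t)) < e"
    using pointwise_closure_approx_compact[OF f g cl K' \<open>e > 0\<close>] by blast
  have int: "set_integrable \<theta> ?K (\<lambda>s. norm (f (s - t)))"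
    using haar_set_integrable_Cu[OF \<theta> shift_in_Cu[OF f] K', of t] by (simp add: shift_def)
  have const: "set_integrable \<theta> ?K (\<lambda>_. e)"
    using meas by (simp add: set_integrable_def less_top)
  have "(LINT s:?K|\<theta>. norm (g s)) \<le> (LINT s:?K|\<theta>. norm (f (s - t)) + e)"
  proof (rule set_integral_mono)
    show "set_integrable \<theta> ?K (\<lambda>s. norm (g s))"
      by (rule haar_set_integrable_Cu[OF \<theta> g K'])
    show "set_integrable \<theta> ?K (\<lambda>s. norm (f (s - t)) + e)"
      using int const by (rule set_integral_add)
    show "norm (g s) \<le> norm (f (s - t)) + e" if "s \<in> ?K" for s
      using t[OF that] norm_triangle_ineq2[of "g s" "f (s - t)"] by linarith
  qed
  also have "\<dots> = (LINT s:?K|\<theta>. norm (f (s - t))) + e * measure \<theta> K"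
    using set_integral_add(2)[OF int const] set_integral_const[OF meas, of e]
    by (simp add: meas_eq mult.commute)
  \<comment> \<open>Since \<open>x + K = t + ((x - t) + K)\<close>, the substitution moves the shift
    from \<open>f\<close> to the set; \<open>x - t\<close> is the witness for the \<open>t\<close>
    of the conclusion.\<close>
  also have "(LINT s:?K|\<theta>. norm (f (s - t))) = (LINT s:((+) (x - t) ` K)|\<theta>. norm (f s))"
  proof -
    have "?K = (+) t ` (+) (x - t) ` K"
      by (simp add: image_image algebra_simps)
    moreover have "(+) (x - t) ` K \<in> sets borel"
      using compact_translate[OF K] by (simp add: compact_imp_closed)
    moreover have "(\<lambda>s. norm (f s)) \<in> borel_measurable borel"
      using Cu_continuous_on[OF f] by (intro borel_measurable_continuous_onI continuous_intros)
    ultimately show ?thesis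
      using haar_set_integral_translate[OF \<theta>, of "\<lambda>s. norm (f s)" "(+) (x - t) ` K" t] by metis
  qed
  finally show thesis using that by blast
qed

section \<open>Vanishing means of absolute values\<close>

lemma has_mean_norm_zero_iff:
  "has_mean \<theta> (\<lambda>x. complex_of_real (norm (f x))) 0 \<longleftrightarrow>
    (\<forall>A. folner_sequence \<theta> A \<longrightarrow> (\<forall>e>0. \<forall>\<^sub>F n in sequentially. \<forall>x.
      (LINT t:((+) x ` A n)|\<theta>. norm (f t)) < e * measure \<theta> (A n)))"
proof -
  have "norm ((LINT t:((+) x ` A n)|\<theta>. complex_of_real (norm (f t))) / complex_of_real (measure \<theta> (A n))) < e
    \<longleftrightarrow> (LINT t:((+) x ` A n)|\<theta>. norm (f t)) < e * measure \<theta> (A n)"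
    if "folner_sequence \<theta> A" for A x n e
  proof -
    \<comment> \<open>Positivity of the measure lets the division be cleared, and nonnegativity of
      the integral lets the norm be dropped, so the complex limit becomes a real inequality.\<close>
    have "0 < measure \<theta> (A n)" using that by (simp add: folner_sequence_def)
    moreover have "0 \<le> (LINT t:((+) x ` A n)|\<theta>. norm (f t))"
      unfolding set_lebesgue_integral_def by (rule Bochner_Integration.integral_nonneg) simp
    ultimately show ?thesis
      unfolding set_integral_complex_of_real norm_divide norm_of_real
      by (simp add: pos_divide_less_eq)
  qed
  then show ?thesis
    unfolding has_mean_def uniform_limit_iff by (simp add: dist_norm cong: imp_cong)
qed

text \<open>Half of \<open>e\<close> pays for the averages of \<open>norm (f t)\<close>, half for
  replacing \<open>g\<close> by a translate of \<open>f\<close>.\<close>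

lemma null_weakly_almost_periodic_pointwise_closure:
  fixes f g :: "'a::{topological_ab_group_add, t2_space} \<Rightarrow> complex"
  assumes \<theta>: "haar_measure \<theta>" and f: "null_weakly_almost_periodic \<theta> f"
    and cl: "g \<in> pointwise_topology closure_of range (\<lambda>t. shift t f)"
  shows "null_weakly_almost_periodic \<theta> g"
proof -
  note wf = f[unfolded null_weakly_almost_periodic_def, THEN conjunct1]
    and mf = f[unfolded null_weakly_almost_periodic_def, THEN conjunct2]
  have wg: "weakly_almost_periodic g"
    using wf cl by (rule weakly_almost_periodic_pointwise_closure)
  have Cu: "f \<in> Cu" "g \<in> Cu"
    by (rule wf[unfolded weakly_almost_periodic_def, THEN conjunct1],
        rule wg[unfolded weakly_almost_periodic_def, THEN conjunct1])
  have "has_mean \<theta> (\<lambda>x. complex_of_real (norm (g x))) 0"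
    unfolding has_mean_norm_zero_iff
  proof (intro allI impI)
    fix A and e :: real
    assume A: "folner_sequence \<theta> A" and "e > 0"
    then have "\<forall>\<^sub>F n in sequentially. \<forall>x.
        (LINT t:((+) x ` A n)|\<theta>. norm (f t)) < e / 2 * measure \<theta> (A n)"
      using mf unfolding has_mean_norm_zero_iff by (meson half_gt_zero)
    then show "\<forall>\<^sub>F n in sequentially. \<forall>x.
        (LINT t:((+) x ` A n)|\<theta>. norm (g t)) < e * measure \<theta> (A n)"
    proof (rule eventually_mono, intro allI)
      fix n x
      assume *: "\<forall>x. (LINT t:((+) x ` A n)|\<theta>. norm (f t)) < e / 2 * measure \<theta> (A n)"
      have "compact (A n)" using A by (simp add: folner_sequence_def)
      \<comment> \<open>Here \<open>t\<close> depends on \<open>n\<close> and \<open>x\<close>,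
        which is harmless because \<open>*\<close> holds for all translates of \<open>A n\<close> at
        once.\<close>
      then obtain t where "(LINT s:((+) x ` A n)|\<theta>. norm (g s))
          \<le> (LINT s:((+) t ` A n)|\<theta>. norm (f s)) + e / 2 * measure \<theta> (A n)"
        using set_integral_norm_pointwise_closure_le[OF \<theta> Cu cl] \<open>e > 0\<close> half_gt_zero by blast
      with *[rule_format, of t]
      have "(LINT s:((+) x ` A n)|\<theta>. norm (g s)) < e / 2 * measure \<theta> (A n) + e / 2 * measure \<theta> (A n)"
        by linarith
      then show "(LINT s:((+) x ` A n)|\<theta>. norm (g s)) < e * measure \<theta> (A n)"
        by (simp flip: distrib_right)
    qed
  qed
  with wg show ?thesis
    unfolding null_weakly_almost_periodic_def by (rule conjI)
qed

section \<open>Test functions in \<open>Cc\<close>\<close>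

lemma Cc_compose_homeomorphism:
  fixes h :: "'a::topological_space \<Rightarrow> 'b::real_normed_vector"
    and p :: "'c::t2_space \<Rightarrow> 'a"
  assumes h: "h \<in> Cc" and p: "continuous_on UNIV p" and q: "continuous_on UNIV q"
    and inv: "\<And>x. q (p x) = x"
  shows "(\<lambda>x. h (p x)) \<in> Cc"
proof -
  let ?S = "closure {x. h x \<noteq> 0}"
  have hc: "continuous_on UNIV h" and hS: "compact ?S"
    using h by (simp_all add: Cc_def)
  have S: "compact (q ` ?S)"
    by (rule compact_continuous_image[OF continuous_on_subset[OF q subset_UNIV] hS])
  \<comment> \<open>The support of the composition is thus a closed subset of the compact image
    under \<open>q\<close> of the support of \<open>h\<close>.\<close>
  have "{x. h (p x) \<noteq> 0} \<subseteq> q ` ?S"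
  proof
    fix x assume "x \<in> {x. h (p x) \<noteq> 0}"
    then have "p x \<in> ?S" by (intro subsetD[OF closure_subset]) simp
    then have "q (p x) \<in> q ` ?S" by (rule imageI)
    then show "x \<in> q ` ?S" by (simp only: inv)
  qed
  then have sub: "closure {x. h (p x) \<noteq> 0} \<subseteq> q ` ?S"
    by (rule closure_minimal[OF _ compact_imp_closed[OF S]])
  have "compact (q ` ?S \<inter> closure {x. h (p x) \<noteq> 0})"
    using S closed_closure by (rule compact_Int_closed)
  then have "compact (closure {x. h (p x) \<noteq> 0})"
    by (simp only: Int_absorb1[OF sub])
  moreover have "continuous_on UNIV (\<lambda>x. h (p x))"
    by (rule continuous_on_compose2[OF hc p subset_UNIV])
  ultimately show ?thesis unfolding Cc_def by blast
qed

lemma Cc_translate: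
  fixes h :: "'a::{topological_ab_group_add, t2_space} \<Rightarrow> 'b::real_normed_vector"
  assumes "h \<in> Cc"
  shows "(\<lambda>s. h (s + t)) \<in> Cc"
  by (rule Cc_compose_homeomorphism[OF assms, where q = "\<lambda>s. s - t"])
    (auto intro: continuous_on_add continuous_on_diff continuous_on_id continuous_on_const)

lemma Cc_reflect:
  fixes h :: "'a::{topological_ab_group_add, t2_space} \<Rightarrow> 'b::real_normed_vector"
  assumes "h \<in> Cc"
  shows "(\<lambda>s. h (t - s)) \<in> Cc"
  by (rule Cc_compose_homeomorphism[OF assms, where q = "\<lambda>s. t - s"])
    (auto intro: continuous_on_diff continuous_on_id continuous_on_const)

text \<open>Locally compact Hausdorff spaces are completely regular, so Urysohn separates
  \<open>K\<close> from the complement of an open \<open>U\<close> that contains \<open>K\<close>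
  and lies in a compact \<open>L\<close>. The function is squeezed between the indicators of
  \<open>K\<close> and \<open>L\<close>.\<close>

lemma Cc_bump_function:
  fixes K :: "'a::t2_space set"
  assumes lc: "locally_compact_space (euclidean :: 'a topology)" and K: "compact K"
  obtains c :: "'a \<Rightarrow> real" and L where "c \<in> Cc" "compact L" "\<And>x. c x \<in> {0..1}"
    "\<And>x. x \<in> K \<Longrightarrow> c x = 1" "\<And>x. x \<notin> L \<Longrightarrow> c x = 0"
proof -
  have H: "Hausdorff_space (euclidean :: 'a topology)"
    by (rule Hausdorff_space_euclidean_t2)
  have "\<exists>U L. openin euclidean U \<and> compactin euclidean L \<and> closedin euclidean L \<and> K \<subseteq> U \<and> U \<subseteq> L"
    using locally_compact_space_compact_closed_compact[OF disjI1[OF H], THEN iffD1, OF lc,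
        THEN spec, THEN mp, OF compactin_euclidean_iff[THEN iffD2, OF K]] .
  then obtain U L where UL: "open U" "compact L" "closed L" "K \<subseteq> U" "U \<subseteq> L"
    unfolding compactin_euclidean_iff open_openin[symmetric] closed_closedin[symmetric] by (elim exE conjE)
  have "completely_regular_space (euclidean :: 'a topology)"
    by (rule locally_compact_regular_imp_completely_regular_space[OF lc disjI1[OF H]])
  moreover have "compactin euclidean K"
    using K by (rule compactin_euclidean_iff[THEN iffD2])
  moreover have "closedin euclidean (- U)"
    using UL(1) unfolding closed_closedin[symmetric] by (rule closed_Compl)
  moreover have "disjnt K (- U)"
    using UL(4) unfolding disjnt_def by blast
  ultimately obtain c :: "'a \<Rightarrow> real" where c: "continuous_map euclidean (subtopology euclidean {0..1}) c"
      "c ` (- U) \<subseteq> {0}" "c ` K \<subseteq> {1}"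
    by (rule Urysohn_completely_regular_compact_closed[OF zero_le_one])
  note c' = c(1)[unfolded continuous_map_in_subtopology continuous_map_iff_continuous2 topspace_euclidean]
  have cont: "continuous_on UNIV c"
    by (rule c'[THEN conjunct1])
  have range: "c x \<in> {0..1}" for x
    using c'[THEN conjunct2] by (rule funcset_mem) simp
  have zero: "c x = 0" if "x \<notin> L" for x
    using c(2) UL(5) that by blast
  then have sub: "closure {x. c x \<noteq> 0} \<subseteq> L"
    by (intro closure_minimal[OF _ \<open>closed L\<close>]) blast
  then have "compact (closure {x. c x \<noteq> 0})"
    using compact_Int_closed[OF \<open>compact L\<close> closed_closure, of "{x. c x \<noteq> 0}"]
    by (simp only: Int_absorb1[OF sub])
  then have "c \<in> Cc" using cont unfolding Cc_def by blast
  moreover have "c x = 1" if "x \<in> K" for x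
    using c(3) that by blast
  ultimately show thesis
    using that[of c L] \<open>compact L\<close> range zero by metis
qed

section \<open>Translation boundedness in terms of test functions\<close>

lemma translation_bounded_bound:
  assumes "translation_bounded \<mu>" "compact K"
  obtains B where "\<And>x h. \<lbrakk>h \<in> Cc; \<And>s. norm (h s) \<le> indicator ((+) x ` K) s\<rbrakk> \<Longrightarrow> norm (\<mu> h) \<le> B"
proof -
  have "(SUP x. variation_compact \<mu> ((+) x ` K)) < \<infinity>"
    using assms unfolding translation_bounded_def by blast
  then obtain C where C: "0 \<le> C" "(SUP x. variation_compact \<mu> ((+) x ` K)) = ennreal C"
    by (cases "SUP x. variation_compact \<mu> ((+) x ` K)") auto
  \<comment> \<open>A strict upper bound is required to pick a \<open>c\<close> from the infimum
    that defines \<open>variation_compact\<close>.\<close>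
  define B where "B = C + 1"
  have B: "(SUP x. variation_compact \<mu> ((+) x ` K)) < ennreal B"
    unfolding C(2) B_def using C(1) by (simp add: ennreal_less_iff)
  have "norm (\<mu> h) \<le> B" if h: "h \<in> Cc" "\<And>s. norm (h s) \<le> indicator ((+) x ` K) s" for x h
  proof -
    have "variation_compact \<mu> ((+) x ` K) < ennreal B"
      using B by (meson SUP_upper UNIV_I le_less_trans)
    then obtain c where c: "c \<in> Cc" "\<And>s. indicator ((+) x ` K) s \<le> c s" "variation \<mu> c < ennreal B"
      unfolding variation_compact_def INF_less_iff by blast
    have "norm (h s) \<le> c s" for s
      using h(2) c(2) order_trans by blast
    then have "ennreal (norm (\<mu> h)) \<le> variation \<mu> c"
      unfolding variation_def using h(1) by (intro SUP_upper) blast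
    then have "ennreal (norm (\<mu> h)) < ennreal B"
      using c(3) by (rule le_less_trans)
    then show ?thesis
      by (simp add: ennreal_less_iff)
  qed
  then show thesis by (rule that)
qed

text \<open>Together with \<open>translation_bounded_bound\<close>, this trades the variation for
  bounds on single values \<open>\<mu> h\<close>, which survive vague limits. A translated bump
  function dominates the indicator of the translate of \<open>K\<close>, and whatever it dominates
  is dominated by the indicator of the translate of the larger set \<open>L\<close>, so the assumed
  bound is used for \<open>L\<close>.\<close>

lemma translation_boundedI:
  fixes \<mu> :: "('a::{topological_ab_group_add, t2_space} \<Rightarrow> complex) \<Rightarrow> complex"
  assumes lc: "locally_compact_space (euclidean :: 'a topology)"
    and bound: "\<And>K. compact K \<Longrightarrow> \<exists>B. \<forall>x. \<forall>h\<in>Cc. (\<forall>s. norm (h s) \<le> indicator ((+) x ` K) s) \<longrightarrow> norm (\<mu> h) \<le> B"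
  shows "translation_bounded \<mu>"
  unfolding translation_bounded_def
proof (intro allI impI)
  fix K :: "'a set" assume "compact K"
  then obtain c :: "'a \<Rightarrow> real" and L where c: "c \<in> Cc" "compact L" "\<And>x. c x \<in> {0..1}"
    "\<And>x. x \<in> K \<Longrightarrow> c x = 1" "\<And>x. x \<notin> L \<Longrightarrow> c x = 0"
    using Cc_bump_function[OF lc] by metis
  obtain B where B: "\<And>x h. h \<in> Cc \<Longrightarrow> (\<forall>s. norm (h s) \<le> indicator ((+) x ` L) s) \<Longrightarrow> norm (\<mu> h) \<le> B"
    using bound[OF c(2)] by blast
  have "variation_compact \<mu> ((+) x ` K) \<le> ennreal B" for x
  proof -
    let ?c = "\<lambda>s. c (s + - x)"
    have "?c \<in> Cc" using c(1) by (rule Cc_translate)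
    moreover have "indicator ((+) x ` K) s \<le> ?c s" for s
      using c(3)[of "s + - x"] c(4)[of "s + - x"]
      by (cases "s - x \<in> K") (simp_all add: indicator_translate)
    ultimately have "variation_compact \<mu> ((+) x ` K) \<le> variation \<mu> ?c"
      unfolding variation_compact_def by (intro INF_lower) blast
    also have "\<dots> \<le> ennreal B"
      unfolding variation_def
    proof (rule SUP_least)
      fix h :: "'a \<Rightarrow> complex" assume h: "h \<in> {h \<in> Cc. \<forall>s. norm (h s) \<le> ?c s}"
      have "?c s \<le> indicator ((+) x ` L) s" for s
        using c(3)[of "s + - x"] c(5)[of "s + - x"]
        by (cases "s - x \<in> L") (simp_all add: indicator_translate)
      then have "norm (\<mu> h) \<le> B"
        using h by (intro B[of h x]) (auto intro: order_trans)
      then show "ennreal (norm (\<mu> h)) \<le> ennreal B" by (rule ennreal_leI)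
    qed
    finally show ?thesis .
  qed
  then have "(SUP x. variation_compact \<mu> ((+) x ` K)) \<le> ennreal B"
    by (rule SUP_least)
  then show "(SUP x. variation_compact \<mu> ((+) x ` K)) < \<infinity>"
    by (rule le_less_trans) (simp add: infinity_ennreal_def)
qed

section \<open>The vague topology and the hull\<close>

lemma topspace_vague_topology: "topspace vague_topology = radon_measures"
  unfolding vague_topology_def radon_measures_def topspace_subtopology topspace_product_topology
  by (auto simp: PiE_def)

lemma continuous_map_vague_eval:
  assumes "h \<in> Cc"
  shows "continuous_map vague_topology euclidean (\<lambda>\<nu>. \<nu> h)"
  unfolding vague_topology_def
  by (rule continuous_map_from_subtopology[OF continuous_map_product_projection[OF assms]])

text \<open>The test function bound for \<open>\<mu>\<close> is uniform over translates of
  \<open>K\<close>, so all measures in the orbit share it. Evaluation at \<open>h\<close> is vaguely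
  continuous and closed discs are closed, so limits of the orbit inherit the same constant.\<close>

lemma translation_bounded_measure_hull:
  fixes \<mu> :: "('a::{topological_ab_group_add, t2_space} \<Rightarrow> complex) \<Rightarrow> complex"
  assumes lc: "locally_compact_space (euclidean :: 'a topology)"
    and \<mu>: "translation_bounded \<mu>" and \<nu>: "\<nu> \<in> measure_hull \<mu>"
  shows "translation_bounded \<nu>"
proof (rule translation_boundedI[OF lc])
  fix K :: "'a set" assume "compact K"
  then obtain B where B: "\<And>x h. \<lbrakk>h \<in> Cc; \<And>s. norm (h s) \<le> indicator ((+) x ` K) s\<rbrakk> \<Longrightarrow> norm (\<mu> h) \<le> B"
    using translation_bounded_bound[OF \<mu>] by blast
  have "norm (\<nu> h) \<le> B" if h: "h \<in> Cc" "\<forall>s. norm (h s) \<le> indicator ((+) x ` K) s" for x h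
  proof -
    have "norm (shift_measure t \<mu> h) \<le> B" for t
    proof -
      have "norm (h (s + t)) \<le> indicator ((+) (x - t) ` K) s" for s
        using h(2)[rule_format, of "s + t"] by (simp add: indicator_translate diff_diff_eq2)
      then have "norm (\<mu> (\<lambda>s. h (s + t))) \<le> B"
        using Cc_translate[OF h(1)] by (intro B)
      then show ?thesis using h(1) by (simp add: shift_measure_def)
    qed
    then have "(\<lambda>\<nu>. \<nu> h) ` range (\<lambda>t. shift_measure t \<mu>) \<subseteq> cball 0 B"
      by auto
    then have "euclidean closure_of ((\<lambda>\<nu>. \<nu> h) ` range (\<lambda>t. shift_measure t \<mu>)) \<subseteq> cball 0 B"
      by (rule closure_of_minimal) simp
    moreover have "\<nu> h \<in> euclidean closure_of ((\<lambda>\<nu>. \<nu> h) ` range (\<lambda>t. shift_measure t \<mu>))"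
      using continuous_map_image_closure_subset[OF continuous_map_vague_eval[OF h(1)]] \<nu>
      unfolding measure_hull_def by blast
    ultimately have "\<nu> h \<in> cball 0 B" by (rule subsetD)
    then show ?thesis by simp
  qed
  then show "\<exists>B. \<forall>x. \<forall>h\<in>Cc. (\<forall>s. norm (h s) \<le> indicator ((+) x ` K) s) \<longrightarrow> norm (\<nu> h) \<le> B"
    by blast
qed

lemma convolve_shift_measure:
  fixes c :: "'a::{topological_ab_group_add, t2_space} \<Rightarrow> complex"
  assumes "c \<in> Cc"
  shows "convolve c (shift_measure t \<mu>) = shift t (convolve c \<mu>)"
  \<comment> \<open>\<open>shift_measure t \<mu>\<close> is \<open>undefined\<close> outside
    \<open>Cc\<close>, so it can be evaluated only because the reflected translates of
    \<open>c\<close> belong to \<open>Cc\<close>.\<close>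
  using Cc_reflect[OF assms]
  by (simp add: convolve_def shift_measure_def shift_def diff_diff_add add.commute)

text \<open>The value of \<open>convolve c \<nu>\<close> at \<open>x\<close> is \<open>\<nu>\<close>
  evaluated at a reflected translate of \<open>c\<close>, so \<open>convolve c\<close> is continuous
  from the vague to the pointwise topology. It also carries the orbit of \<open>\<mu>\<close> to the
  orbit of \<open>convolve c \<mu>\<close>, hence closure into closure.\<close>

lemma convolve_measure_hull:
  fixes c :: "'a::{topological_ab_group_add, t2_space} \<Rightarrow> complex"
  assumes c: "c \<in> Cc" and \<nu>: "\<nu> \<in> measure_hull \<mu>"
  shows "convolve c \<nu> \<in> pointwise_topology closure_of range (\<lambda>t. shift t (convolve c \<mu>))"
proof -
  have "continuous_map vague_topology pointwise_topology (convolve c)"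
    unfolding continuous_map_componentwise_UNIV convolve_def
    by (intro allI continuous_map_vague_eval Cc_reflect c)
  then have "convolve c \<nu> \<in> pointwise_topology closure_of (convolve c ` range (\<lambda>t. shift_measure t \<mu>))"
    using continuous_map_image_closure_subset \<nu> unfolding measure_hull_def by blast
  then show ?thesis
    by (simp only: image_image convolve_shift_measure[OF c])
qed

theorem proposition3p13:
  fixes \<theta> :: "'a::{topological_ab_group_add, t2_space} measure"
    and \<mu> :: "('a \<Rightarrow> complex) \<Rightarrow> complex"
  assumes "locally_compact_space (euclidean :: 'a topology)"
    and "haar_measure \<theta>"
    and "\<exists>A. folner_sequence \<theta> A"
    and "\<mu> \<in> WAP0 \<theta>"
  shows "measure_hull \<mu> \<subseteq> WAP0 \<theta>"
proof
  fix \<nu> assume \<nu>: "\<nu> \<in> measure_hull \<mu>"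
  have \<mu>: "translation_bounded \<mu>" "\<And>c. c \<in> Cc \<Longrightarrow> null_weakly_almost_periodic \<theta> (convolve c \<mu>)"
    using assms(4) unfolding WAP0_def by blast+
  \<comment> \<open>The closure is taken inside the vague topology, whose carrier is
    \<open>radon_measures\<close>.\<close>
  have "\<nu> \<in> radon_measures"
    using \<nu> closure_of_subset_topspace[of vague_topology]
    unfolding measure_hull_def topspace_vague_topology by blast
  moreover have "translation_bounded \<nu>"
    using assms(1) \<mu>(1) \<nu> by (rule translation_bounded_measure_hull)
  moreover have "null_weakly_almost_periodic \<theta> (convolve c \<nu>)" if "c \<in> Cc" for c
    using null_weakly_almost_periodic_pointwise_closure[OF assms(2) \<mu>(2)[OF that]
        convolve_measure_hull[OF that \<nu>]] .
  ultimately show "\<nu> \<in> WAP0 \<theta>"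
    unfolding WAP0_def by blast
qed

end
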